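(* Let $G$ be a simple graph and $r\ge 0$ an integer. The following are equivalent: (1) $G$ is $r$-locally acyclic; (2) $G$ has girth greater than $r$ (i.e., $G$ has no cycle of length at most $r$); (3) the $r$-local cover $G_r$ of $G$ is acyclic (i.e., a forest).
   Context: $B_G(v,r/2)$ is the subgraph consisting of vertices at distance at most $r/2$ from $v$ and edges whose endpoints' distances to $v$ sum to strictly less than $r$. $G$ is $r$-locally acyclic if $B_G(v,r/2)$ is acyclic for every vertex $v$. A covering of $G$ is a surjective homomorphism $p\colon\hat G\to G$ restricting, at each vertex $\hat v$, to a bijection between the edges at $\hat v$ and the edges at $p(\hat v)$, such that $p^{-1}(C)$ is connected for every component $C$ of $G$. It is $r/2$-ball-preserving if it restricts to an isomorphism $B_{\hat G}(\hat v,r/2)\to B_G(p(\hat v),r/2)$ for every $\hat v$. The $r$-local covering $p_r\colon G_r\to G$ is the universal $r/2$-ball-preserving covering (every $r/2$-ball-preserving covering $p$ satisfies $p_r=p\circ q$ for some covering $q$), and $G_r$ is the $r$-local cover. *)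

theory Defs
  imports Main "HOL-Library.Extended_Nat"
begin

section \<open>Simple graphs\<close>

text \<open>Graphs may be infinite and need not be connected.\<close>

datatype 'a graph = Graph (verts: "'a set") (edges: "'a set set")

definition simple_graph :: "'a graph \<Rightarrow> bool" where
  "simple_graph G \<longleftrightarrow> (\<forall>e\<in>edges G. e \<subseteq> verts G \<and> card e = 2)"

definition edges_at :: "'a graph \<Rightarrow> 'a \<Rightarrow> 'a set set" where
  "edges_at G v = {e \<in> edges G. v \<in> e}"

definition walk :: "'a graph \<Rightarrow> 'a list \<Rightarrow> bool" where
  "walk G vs \<longleftrightarrow> vs \<noteq> [] \<and> set vs \<subseteq> verts G \<and> successively (\<lambda>x y. {x, y} \<in> edges G) vs"

definition walk_betw :: "'a graph \<Rightarrow> 'a \<Rightarrow> 'a list \<Rightarrow> 'a \<Rightarrow> bool" where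
  "walk_betw G u vs v \<longleftrightarrow> walk G vs \<and> hd vs = u \<and> last vs = v"

definition connected_graph :: "'a graph \<Rightarrow> bool" where
  "connected_graph G \<longleftrightarrow> (\<forall>u\<in>verts G. \<forall>v\<in>verts G. \<exists>vs. walk_betw G u vs v)"

definition induced_subgraph :: "'a graph \<Rightarrow> 'a set \<Rightarrow> 'a graph" where
  "induced_subgraph G U = Graph (verts G \<inter> U) {e \<in> edges G. e \<subseteq> U}"

definition components :: "'a graph \<Rightarrow> 'a graph set" where
  "components G = (\<lambda>v. induced_subgraph G {u. \<exists>vs. walk_betw G v vs u}) ` verts G"

text \<open>The distance is \<open>\<infinity>\<close> between vertices of different components.\<close>

definition gdist :: "'a graph \<Rightarrow> 'a \<Rightarrow> 'a \<Rightarrow> enat" where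
  "gdist G u v = (INF vs\<in>{vs. walk_betw G u vs v}. enat (length vs - 1))"

text \<open>A cycle of length \<open>n\<close> is given by the list of its \<open>n\<close> vertices in cyclic order.\<close>

definition is_cycle :: "'a graph \<Rightarrow> 'a list \<Rightarrow> bool" where
  "is_cycle G c \<longleftrightarrow> 3 \<le> length c \<and> distinct c \<and> walk G c \<and> {last c, hd c} \<in> edges G"

definition acyclic_graph :: "'a graph \<Rightarrow> bool" where
  "acyclic_graph G \<longleftrightarrow> (\<nexists>c. is_cycle G c)"

text \<open>The girth of an acyclic graph is \<open>\<infinity>\<close>.\<close>

definition girth :: "'a graph \<Rightarrow> enat" where
  "girth G = (INF c\<in>{c. is_cycle G c}. enat (length c))"

definition graph_iso :: "'a graph \<Rightarrow> 'b graph \<Rightarrow> ('a \<Rightarrow> 'b) \<Rightarrow> bool" where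
  "graph_iso G H f \<longleftrightarrow> bij_betw f (verts G) (verts H) \<and>
     (\<forall>x\<in>verts G. \<forall>y\<in>verts G. {x, y} \<in> edges G \<longleftrightarrow> {f x, f y} \<in> edges H)"


section \<open>Balls and local acyclicity\<close>

text \<open>\<open>ball_half G v r\<close> is the ball of radius \<open>r/2\<close> around \<open>v\<close>; the bound on the
  distance is doubled to avoid fractions.\<close>

definition ball_half :: "'a graph \<Rightarrow> 'a \<Rightarrow> nat \<Rightarrow> 'a graph" where
  "ball_half G v r = Graph {u \<in> verts G. 2 * gdist G v u \<le> enat r}
                           {e \<in> edges G. (\<Sum>u\<in>e. gdist G v u) < enat r}"

definition locally_acyclic :: "nat \<Rightarrow> 'a graph \<Rightarrow> bool" where
  "locally_acyclic r G \<longleftrightarrow> (\<forall>v\<in>verts G. acyclic_graph (ball_half G v r))"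


section \<open>Coverings\<close>

definition preimage_subgraph :: "('b \<Rightarrow> 'a) \<Rightarrow> 'b graph \<Rightarrow> 'a graph \<Rightarrow> 'b graph" where
  "preimage_subgraph p H C = Graph {v \<in> verts H. p v \<in> verts C} {e \<in> edges H. p ` e \<in> edges C}"

definition surj_hom :: "'b graph \<Rightarrow> 'a graph \<Rightarrow> ('b \<Rightarrow> 'a) \<Rightarrow> bool" where
  "surj_hom H G p \<longleftrightarrow> p ` verts H = verts G \<and> (\<lambda>e. p ` e) ` edges H = edges G"

definition covering :: "'b graph \<Rightarrow> 'a graph \<Rightarrow> ('b \<Rightarrow> 'a) \<Rightarrow> bool" where
  "covering H G p \<longleftrightarrow> simple_graph H \<and> simple_graph G \<and> surj_hom H G p \<and>
     (\<forall>v\<in>verts H. bij_betw (\<lambda>e. p ` e) (edges_at H v) (edges_at G (p v))) \<and>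
     (\<forall>C\<in>components G. connected_graph (preimage_subgraph p H C))"

definition ball_preserving :: "nat \<Rightarrow> 'b graph \<Rightarrow> 'a graph \<Rightarrow> ('b \<Rightarrow> 'a) \<Rightarrow> bool" where
  "ball_preserving r H G p \<longleftrightarrow>
     (\<forall>v\<in>verts H. graph_iso (ball_half H v r) (ball_half G (p v) r) p)"

text \<open>\<open>local_covering r Gr G pr\<close>: the map \<open>pr\<close> is the \<open>r\<close>-local covering of \<open>G\<close>, and \<open>Gr\<close> its
  \<open>r\<close>-local cover, both of which are determined up to isomorphism. HOL cannot quantify over the
  type of the vertices of the competing coverings \<open>H\<close>, so these are taken on lists over the
  vertex type of \<open>G\<close>. This is no restriction, since a vertex of a covering is determined by the
  projection of a walk to it: see \<open>local_covering_universal\<close> below, where the vertex type of \<open>H\<close>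
  is arbitrary, and \<open>local_covering_exists\<close>.\<close>

definition local_covering :: "nat \<Rightarrow> 'b graph \<Rightarrow> 'a graph \<Rightarrow> ('b \<Rightarrow> 'a) \<Rightarrow> bool" where
  "local_covering r Gr G pr \<longleftrightarrow> covering Gr G pr \<and> ball_preserving r Gr G pr \<and>
     (\<forall>(H :: 'a list graph) p. covering H G p \<and> ball_preserving r H G p \<longrightarrow>
        (\<exists>q. covering Gr H q \<and> (\<forall>x\<in>verts Gr. pr x = p (q x))))"


section \<open>Universality and existence of the local covering\<close>

definition adj :: "'a graph \<Rightarrow> 'a \<Rightarrow> 'a \<Rightarrow> bool" where
  "adj G x y \<longleftrightarrow> {x, y} \<in> edges G"

lemma adj_verts: "simple_graph G \<Longrightarrow> adj G x y \<Longrightarrow> x \<in> verts G \<and> y \<in> verts G \<and> x \<noteq> y"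
  unfolding simple_graph_def adj_def by fastforce

lemma adj_sym: "adj G x y \<Longrightarrow> adj G y x"
  by (simp add: adj_def insert_commute)

lemma adj_rtranclp_sym: "(adj G)\<^sup>*\<^sup>* x y \<Longrightarrow> (adj G)\<^sup>*\<^sup>* y x"
  by (induction rule: rtranclp_induct) (auto intro: converse_rtranclp_into_rtranclp adj_sym)

lemma edge_obtain:
  assumes "simple_graph G" "e \<in> edges G" "x \<in> e"
  obtains y where "e = {x, y}" "adj G x y"
proof -
  have "card e = 2" using assms by (auto simp: simple_graph_def)
  then obtain a b where "e = {a, b}" by (auto simp: card_2_iff)
  then have "\<exists>y. e = {x, y}" using assms(3) by auto
  then show thesis using that assms(2) by (auto simp: adj_def)
qed

lemma adj_pow_verts: "simple_graph G \<Longrightarrow> u \<in> verts G \<Longrightarrow> (adj G ^^ n) u v \<Longrightarrow> v \<in> verts G"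
  by (cases n) (auto dest: adj_verts)

lemma adj_rtranclp_verts: "simple_graph G \<Longrightarrow> u \<in> verts G \<Longrightarrow> (adj G)\<^sup>*\<^sup>* u v \<Longrightarrow> v \<in> verts G"
  by (metis adj_pow_verts rtranclp_imp_relpowp)

lemma walk_Cons: "walk G (x # xs) \<longleftrightarrow> x \<in> verts G \<and> (xs = [] \<or> adj G x (hd xs) \<and> walk G xs)"
  by (auto simp: walk_def adj_def successively_Cons)

lemma walk_pow: "walk G vs \<Longrightarrow> (adj G ^^ (length vs - 1)) (hd vs) (last vs)"
proof (induction vs)
  case (Cons x xs)
  show ?case
  proof (cases xs)
    case (Cons y ys)
    then show ?thesis using Cons.IH Cons.prems
      by (auto simp: walk_Cons simp del: relpowp.simps intro: relpowp_Suc_I2)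
  qed simp
qed (simp add: walk_def)

lemma pow_walk:
  assumes "simple_graph G"
  shows "u \<in> verts G \<Longrightarrow> (adj G ^^ n) u v \<Longrightarrow> \<exists>vs. walk_betw G u vs v \<and> length vs = Suc n"
proof (induction n arbitrary: u)
  case 0
  then show ?case by (intro exI[of _ "[u]"]) (auto simp: walk_betw_def walk_def)
next
  case (Suc n)
  then obtain w where w: "adj G u w" "(adj G ^^ n) w v"
    by (metis relpowp_Suc_D2)
  then obtain vs where "walk_betw G w vs v" "length vs = Suc n"
    using Suc.IH adj_verts[OF assms w(1)] by blast
  then show ?case using w(1) Suc.prems(1)
    by (intro exI[of _ "u # vs"]) (auto simp: walk_betw_def walk_Cons)
qed

lemma walk_betw_iff:
  assumes "simple_graph G"
  shows "(\<exists>vs. walk_betw G u vs v) \<longleftrightarrow> u \<in> verts G \<and> (adj G)\<^sup>*\<^sup>* u v"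
proof
  assume "\<exists>vs. walk_betw G u vs v"
  then show "u \<in> verts G \<and> (adj G)\<^sup>*\<^sup>* u v"
    unfolding walk_betw_def using walk_pow
    by (metis hd_in_set relpowp_imp_rtranclp subset_iff walk_def)
next
  assume "u \<in> verts G \<and> (adj G)\<^sup>*\<^sup>* u v"
  then show "\<exists>vs. walk_betw G u vs v"
    using pow_walk[OF assms] by (metis rtranclp_imp_relpowp)
qed

lemma gdist_le:
  assumes "simple_graph G" "u \<in> verts G" "(adj G ^^ n) u v"
  shows "gdist G u v \<le> enat n"
proof -
  obtain vs where "walk_betw G u vs v" "length vs = Suc n" using pow_walk[OF assms] by blast
  then show ?thesis unfolding gdist_def by (metis (mono_tags) INF_lower diff_Suc_1 mem_Collect_eq)
qed

lemma gdist_pow: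
  assumes "gdist G u v = enat n"
  shows "(adj G ^^ n) u v"
proof -
  let ?S = "(\<lambda>vs. enat (length vs - 1)) ` {vs. walk_betw G u vs v}"
  have "?S \<noteq> {}" using assms unfolding gdist_def by (metis Inf_enat_def enat.simps(3))
  then have "Inf ?S \<in> ?S" by (simp add: Inf_enat_def LeastI_ex ex_in_conv del: image_is_empty)
      (metis (mono_tags, lifting) LeastI_ex ex_in_conv)
  then obtain vs where "walk_betw G u vs v" "length vs - 1 = n"
    using assms unfolding gdist_def by auto
  then show ?thesis using walk_pow by (auto simp: walk_betw_def)
qed

lemma covering_iff:
  "covering H G p \<longleftrightarrow> simple_graph H \<and> simple_graph G \<and> p ` verts H = verts G \<and>
     (\<forall>x y. adj H x y \<longrightarrow> adj G (p x) (p y)) \<and>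
     (\<forall>x\<in>verts H. \<forall>b. adj G (p x) b \<longrightarrow> (\<exists>!y. adj H x y \<and> p y = b)) \<and>
     (\<forall>x\<in>verts H. \<forall>y\<in>verts H. (adj G)\<^sup>*\<^sup>* (p x) (p y) \<longrightarrow> (adj H)\<^sup>*\<^sup>* x y)"
  (is "_ \<longleftrightarrow> ?R")
proof (cases "simple_graph H \<and> simple_graph G \<and> p ` verts H = verts G \<and>
     (\<forall>x y. adj H x y \<longrightarrow> adj G (p x) (p y))")
  case False
  have "adj G (p x) (p y)" if "covering H G p" "adj H x y" for x y
  proof -
    have "p ` {x, y} \<in> edges G" using that unfolding covering_def surj_hom_def adj_def by blast
    then show ?thesis by (simp add: adj_def)
  qed
  then show ?thesis using False by (auto simp: covering_def surj_hom_def)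
next
  case True
  then have sH: "simple_graph H" and sG: "simple_graph G" and surj: "p ` verts H = verts G"
    and hom: "\<And>x y. adj H x y \<Longrightarrow> adj G (p x) (p y)" by auto
  have local: "bij_betw (\<lambda>e. p ` e) (edges_at H x) (edges_at G (p x)) \<longleftrightarrow>
     (\<forall>b. adj G (p x) b \<longrightarrow> (\<exists>!y. adj H x y \<and> p y = b))" (is "?A \<longleftrightarrow> ?B") if x: "x \<in> verts H" for x
  proof
    assume A: ?A
    show ?B
    proof (intro allI impI ex_ex1I)
      fix b assume b: "adj G (p x) b"
      then have "{p x, b} \<in> edges_at G (p x)" by (auto simp: edges_at_def adj_def)
      then obtain e where e: "e \<in> edges_at H x" "p ` e = {p x, b}"
        using A by (metis bij_betw_imp_surj_on imageE)
      then obtain y where y: "e = {x, y}" "adj H x y"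
        using edge_obtain[OF sH, of e x] by (auto simp: edges_at_def)
      then have "p y = b" using e(2) adj_verts[OF sG b] by (auto simp: doubleton_eq_iff)
      then show "\<exists>y. adj H x y \<and> p y = b" using y by blast
    next
      fix b y y' assume *: "adj H x y \<and> p y = b" "adj H x y' \<and> p y' = b"
      then have "{x, y} \<in> edges_at H x" "{x, y'} \<in> edges_at H x" "p ` {x, y} = p ` {x, y'}"
        by (auto simp: edges_at_def adj_def)
      then have "{x, y} = {x, y'}" using A by (meson bij_betw_def inj_onD)
      then show "y = y'" by (auto simp: doubleton_eq_iff)
    qed
  next
    assume B: ?B
    have "inj_on (\<lambda>e. p ` e) (edges_at H x)"
    proof (rule inj_onI)
      fix e e' assume *: "e \<in> edges_at H x" "e' \<in> edges_at H x" "p ` e = p ` e'"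
      obtain y where y: "e = {x, y}" "adj H x y"
        using edge_obtain[OF sH, of e x] *(1) by (auto simp: edges_at_def)
      obtain y' where y': "e' = {x, y'}" "adj H x y'"
        using edge_obtain[OF sH, of e' x] *(2) by (auto simp: edges_at_def)
      have "p y = p y'" using *(3) y y' by (auto simp: doubleton_eq_iff)
      then show "e = e'" using B hom y y' by metis
    qed
    moreover have "(\<lambda>e. p ` e) ` edges_at H x = edges_at G (p x)"
    proof (intro equalityI subsetI)
      fix e assume "e \<in> (\<lambda>e. p ` e) ` edges_at H x"
      then obtain e' where e': "e' \<in> edges_at H x" "e = p ` e'" by blast
      then obtain y where y: "e' = {x, y}" "adj H x y"
        using edge_obtain[OF sH, of e' x] by (auto simp: edges_at_def)
      then show "e \<in> edges_at G (p x)" using hom[OF y(2)] e' by (auto simp: edges_at_def adj_def)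
    next
      fix e assume e: "e \<in> edges_at G (p x)"
      then obtain b where b: "e = {p x, b}" "adj G (p x) b"
        using edge_obtain[OF sG, of e "p x"] by (auto simp: edges_at_def)
      then obtain y where "adj H x y" "p y = b" using B by blast
      then have "{x, y} \<in> edges_at H x" "p ` {x, y} = e" using b by (auto simp: edges_at_def adj_def)
      then show "e \<in> (\<lambda>e. p ` e) ` edges_at H x" by blast
    qed
    ultimately show ?A by (simp add: bij_betw_def)
  qed
  have esurj: "(\<lambda>e. p ` e) ` edges H = edges G"
    if B: "\<forall>x\<in>verts H. bij_betw (\<lambda>e. p ` e) (edges_at H x) (edges_at G (p x))"
  proof (intro equalityI subsetI)
    fix e assume "e \<in> (\<lambda>e. p ` e) ` edges H"
    then obtain e' where e': "e' \<in> edges H" "e = p ` e'" by blast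
    then have "card e' = 2" using sH by (auto simp: simple_graph_def)
    then obtain x y where "e' = {x, y}" by (auto simp: card_2_iff)
    then show "e \<in> edges G" using hom[of x y] e' by (auto simp: adj_def)
  next
    fix e assume e: "e \<in> edges G"
    then have "card e = 2" "e \<subseteq> verts G" using sG by (auto simp: simple_graph_def)
    then obtain a where "a \<in> e" "a \<in> verts G" by (auto simp: card_2_iff)
    then obtain x where "x \<in> verts H" "p x \<in> e" using surj by (metis imageE)
    then have "e \<in> (\<lambda>e. p ` e) ` edges_at H x"
      using B e by (simp add: bij_betw_def edges_at_def)
    then show "e \<in> (\<lambda>e. p ` e) ` edges H" by (auto simp: edges_at_def)
  qed
  have conn: "(\<forall>C\<in>components G. connected_graph (preimage_subgraph p H C)) \<longleftrightarrow>
     (\<forall>x\<in>verts H. \<forall>y\<in>verts H. (adj G)\<^sup>*\<^sup>* (p x) (p y) \<longrightarrow> (adj H)\<^sup>*\<^sup>* x y)"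
    (is "?A \<longleftrightarrow> ?B")
  proof -
    define C where "C v = induced_subgraph G {u. \<exists>vs. walk_betw G v vs u}" for v
    have vC: "verts (C v) = {u. (adj G)\<^sup>*\<^sup>* v u}" if "v \<in> verts G" for v
      using that adj_rtranclp_verts[OF sG]
      by (auto simp: C_def induced_subgraph_def walk_betw_iff[OF sG])
    have aC: "adj (C v) x y \<longleftrightarrow> adj G x y \<and> (adj G)\<^sup>*\<^sup>* v x \<and> (adj G)\<^sup>*\<^sup>* v y" if "v \<in> verts G" for v x y
      using that
      by (auto simp: C_def induced_subgraph_def walk_betw_iff[OF sG] adj_def)
    let ?P = "\<lambda>v. preimage_subgraph p H (C v)"
    have sP: "simple_graph (?P v)" if v: "v \<in> verts G" for v
      unfolding simple_graph_def preimage_subgraph_def graph.sel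
    proof
      fix e assume e: "e \<in> {e \<in> edges H. p ` e \<in> edges (C v)}"
      then have "card e = 2" "e \<subseteq> verts H" "p ` e \<in> edges (C v)"
        using sH by (auto simp: simple_graph_def)
      moreover from this have "p ` e \<subseteq> verts (C v)"
        using sG unfolding C_def induced_subgraph_def simple_graph_def graph.sel by simp
      ultimately show "e \<subseteq> {u \<in> verts H. p u \<in> verts (C v)} \<and> card e = 2" by auto
    qed
    have aP: "adj (?P v) x y \<longleftrightarrow> adj H x y \<and> (adj G)\<^sup>*\<^sup>* v (p x)" if v: "v \<in> verts G" for v x y
    proof -
      have "adj (?P v) x y \<longleftrightarrow> adj H x y \<and> adj (C v) (p x) (p y)"
        by (auto simp: adj_def preimage_subgraph_def)
      then show ?thesis using aC[OF v] hom by (metis rtranclp.rtrancl_into_rtrancl)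
    qed
    have reach: "(adj (?P v))\<^sup>*\<^sup>* x y \<longleftrightarrow> (adj H)\<^sup>*\<^sup>* x y"
      if v: "v \<in> verts G" and x: "(adj G)\<^sup>*\<^sup>* v (p x)" for v x y
    proof
      show "(adj H)\<^sup>*\<^sup>* x y" if "(adj (?P v))\<^sup>*\<^sup>* x y"
        using that by (rule rtranclp_mono[THEN predicate2D, rotated]) (auto simp: aP[OF v])
      show "(adj (?P v))\<^sup>*\<^sup>* x y" if "(adj H)\<^sup>*\<^sup>* x y"
      proof -
        have "(adj (?P v))\<^sup>*\<^sup>* x y \<and> (adj G)\<^sup>*\<^sup>* v (p y)" using that
        proof (induction rule: rtranclp_induct)
          case (step y z)
          then show ?case using aP[OF v, of y z] hom by (meson rtranclp.rtrancl_into_rtrancl)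
        qed (use x in auto)
        then show ?thesis by blast
      qed
    qed
    have "?A \<longleftrightarrow> (\<forall>v\<in>verts G. connected_graph (?P v))"
      by (auto simp: components_def C_def)
    also have "\<dots> \<longleftrightarrow> (\<forall>v\<in>verts G. \<forall>x\<in>verts H. \<forall>y\<in>verts H.
        (adj G)\<^sup>*\<^sup>* v (p x) \<longrightarrow> (adj G)\<^sup>*\<^sup>* v (p y) \<longrightarrow> (adj H)\<^sup>*\<^sup>* x y)"
    proof (rule ball_cong[OF refl])
      fix v assume v: "v \<in> verts G"
      have vP: "x \<in> verts (?P v) \<longleftrightarrow> x \<in> verts H \<and> (adj G)\<^sup>*\<^sup>* v (p x)" for x
        using vC[OF v] by (auto simp: preimage_subgraph_def)
      show "connected_graph (?P v) \<longleftrightarrow> (\<forall>x\<in>verts H. \<forall>y\<in>verts H.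
        (adj G)\<^sup>*\<^sup>* v (p x) \<longrightarrow> (adj G)\<^sup>*\<^sup>* v (p y) \<longrightarrow> (adj H)\<^sup>*\<^sup>* x y)"
        unfolding connected_graph_def walk_betw_iff[OF sP[OF v]] Ball_def vP
        using reach[OF v] by blast
    qed
    also have "\<dots> \<longleftrightarrow> ?B"
    proof
      assume L: "\<forall>v\<in>verts G. \<forall>x\<in>verts H. \<forall>y\<in>verts H.
        (adj G)\<^sup>*\<^sup>* v (p x) \<longrightarrow> (adj G)\<^sup>*\<^sup>* v (p y) \<longrightarrow> (adj H)\<^sup>*\<^sup>* x y"
      show ?B using L surj by (metis imageI rtranclp.rtrancl_refl)
    next
      assume ?B
      then show "\<forall>v\<in>verts G. \<forall>x\<in>verts H. \<forall>y\<in>verts H.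
        (adj G)\<^sup>*\<^sup>* v (p x) \<longrightarrow> (adj G)\<^sup>*\<^sup>* v (p y) \<longrightarrow> (adj H)\<^sup>*\<^sup>* x y"
        by (meson adj_rtranclp_sym rtranclp_trans)
    qed
    finally show ?thesis .
  qed
  have aux: "A \<longleftrightarrow> s \<and> t \<and> u \<and> v \<and> x \<and> y"
    if "A \<longleftrightarrow> x \<and> y" "s \<and> t \<and> u \<and> v" for A s t u v x y :: bool
    using that by blast
  define L where "L \<longleftrightarrow> (\<forall>x\<in>verts H. bij_betw (\<lambda>e. p ` e) (edges_at H x) (edges_at G (p x)))"
  define C where "C \<longleftrightarrow> (\<forall>C\<in>components G. connected_graph (preimage_subgraph p H C))"
  have "covering H G p \<longleftrightarrow> (\<lambda>e. p ` e) ` edges H = edges G \<and> L \<and> C"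
    unfolding covering_def surj_hom_def L_def C_def using sH sG surj by simp
  also have "\<dots> \<longleftrightarrow> L \<and> C" using esurj[folded L_def] by blast
  also have "L \<longleftrightarrow> (\<forall>x\<in>verts H. \<forall>b. adj G (p x) b \<longrightarrow> (\<exists>!y. adj H x y \<and> p y = b))"
    unfolding L_def by (rule ball_cong[OF refl local])
  also have "C \<longleftrightarrow> (\<forall>x\<in>verts H. \<forall>y\<in>verts H. (adj G)\<^sup>*\<^sup>* (p x) (p y) \<longrightarrow> (adj H)\<^sup>*\<^sup>* x y)"
    unfolding C_def by (rule conn)
  finally show ?thesis by (rule aux[OF _ True])
qed

lemma covering_hom: "covering H G p \<Longrightarrow> adj H x y \<Longrightarrow> adj G (p x) (p y)"
  by (simp add: covering_iff)

lemma covering_verts: "covering H G p \<Longrightarrow> x \<in> verts H \<Longrightarrow> p x \<in> verts G"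
  by (auto simp: covering_iff)

lemma covering_lift:
  "covering H G p \<Longrightarrow> x \<in> verts H \<Longrightarrow> adj G (p x) b \<Longrightarrow> \<exists>y. adj H x y \<and> p y = b"
  unfolding covering_iff by blast

lemma covering_inj:
  "covering H G p \<Longrightarrow> adj H x y \<Longrightarrow> adj H x z \<Longrightarrow> p y = p z \<Longrightarrow> y = z"
proof -
  assume a: "covering H G p" "adj H x y" "adj H x z" "p y = p z"
  then have "x \<in> verts H" "adj G (p x) (p y)"
    using adj_verts[of H x y] covering_hom[OF a(1,2)] by (auto simp: covering_def)
  then have "\<exists>!w. adj H x w \<and> p w = p y" using a(1) unfolding covering_iff by blast
  then show "y = z" using a by auto
qed

lemma covering_surj: "covering H G p \<Longrightarrow> a \<in> verts G \<Longrightarrow> \<exists>x\<in>verts H. p x = a"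
  unfolding covering_def surj_hom_def by (metis imageE)

lemma covering_conn:
  "covering H G p \<Longrightarrow> x \<in> verts H \<Longrightarrow> y \<in> verts H \<Longrightarrow> (adj G)\<^sup>*\<^sup>* (p x) (p y) \<Longrightarrow> (adj H)\<^sup>*\<^sup>* x y"
  unfolding covering_iff by blast

lemma covering_pow: "covering H G p \<Longrightarrow> (adj H ^^ n) x y \<Longrightarrow> (adj G ^^ n) (p x) (p y)"
  by (induction n arbitrary: y) (auto dest: covering_hom)

lemma covering_rtranclp: "covering H G p \<Longrightarrow> (adj H)\<^sup>*\<^sup>* x y \<Longrightarrow> (adj G)\<^sup>*\<^sup>* (p x) (p y)"
  by (metis covering_pow relpowp_imp_rtranclp rtranclp_imp_relpowp)

lemma covering_lift_pow:
  assumes "covering H G p" "x \<in> verts H"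
  shows "(adj G ^^ n) (p x) b \<Longrightarrow> \<exists>y. (adj H ^^ n) x y \<and> p y = b"
proof (induction n arbitrary: b)
  case (Suc n)
  then obtain c where c: "(adj G ^^ n) (p x) c" "adj G c b" by auto
  then obtain y where y: "(adj H ^^ n) x y" "p y = c" using Suc.IH by blast
  then have "y \<in> verts H" using adj_pow_verts assms by (metis covering_def)
  then obtain z where "adj H y z" "p z = b" using covering_lift[OF assms(1)] c(2) y(2) by blast
  then show ?case using y by auto
qed simp

lemma covering_factor:
  assumes P: "covering P G pr" and H: "covering H G p"
    and qv: "\<And>x. x \<in> verts P \<Longrightarrow> q x \<in> verts H"
    and qe: "\<And>x y. adj P x y \<Longrightarrow> adj H (q x) (q y)"
    and eq: "\<And>x. x \<in> verts P \<Longrightarrow> pr x = p (q x)"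
  shows "covering P H q"
proof -
  have sP: "simple_graph P" and sH: "simple_graph H" using P H by (auto simp: covering_def)
  have lift: "\<exists>y. adj P x y \<and> q y = b" if x: "x \<in> verts P" and b: "adj H (q x) b" for x b
  proof -
    have "adj G (pr x) (p b)" using covering_hom[OF H b] eq[OF x] by simp
    then obtain y where y: "adj P x y" "pr y = p b" using covering_lift[OF P x] by blast
    then have "y \<in> verts P" using adj_verts[OF sP] by blast
    then have "q y = b" using covering_inj[OF H qe[OF y(1)] b] eq y(2) by simp
    then show ?thesis using y by blast
  qed
  have surj: "b \<in> q ` verts P" if b: "b \<in> verts H" for b
  proof -
    obtain x where x: "x \<in> verts P" "pr x = p b"
      using covering_surj[OF P covering_verts[OF H b]] by blast
    then have "(adj H)\<^sup>*\<^sup>* (q x) b" using covering_conn[OF H qv[OF x(1)] b] eq[OF x(1)] by simp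
    then show ?thesis
    proof (induction rule: rtranclp_induct)
      case (step y z)
      then obtain x' where "x' \<in> verts P" "q x' = y" by blast
      then show ?case using lift[of x' z] step(2) adj_verts[OF sP] by blast
    qed (use x in blast)
  qed
  show ?thesis unfolding covering_iff
  proof (intro conjI ballI allI impI)
    show "q ` verts P = verts H" using surj qv by blast
    fix x assume x: "x \<in> verts P"
    show "\<exists>!y. adj P x y \<and> q y = b" if b: "adj H (q x) b" for b
    proof (rule ex_ex1I)
      fix y z assume "adj P x y \<and> q y = b" "adj P x z \<and> q z = b"
      then show "y = z" using covering_inj[OF P, of x y z] eq adj_verts[OF sP] by metis
    qed (rule lift[OF x b])
    show "(adj P)\<^sup>*\<^sup>* x y" if "y \<in> verts P" "(adj H)\<^sup>*\<^sup>* (q x) (q y)" for y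
      using covering_rtranclp[OF H that(2)] eq[OF x] eq[OF that(1)] covering_conn[OF P x that(1)]
      by simp
  qed (use sP sH qe in auto)
qed

lemma ball_half_edge:
  assumes "x \<noteq> y"
  shows "{x, y} \<in> edges (ball_half G v r) \<longleftrightarrow> adj G x y \<and> gdist G v x + gdist G v y < enat r"
  using assms by (auto simp: ball_half_def adj_def)

lemma ball_halfE:
  assumes "x \<in> verts (ball_half G v r)"
  obtains n where "gdist G v x = enat n" "2 * n \<le> r" "x \<in> verts G" "(adj G ^^ n) v x"
proof -
  have *: "2 * gdist G v x \<le> enat r" "x \<in> verts G" using assms by (auto simp: ball_half_def)
  obtain n where n: "gdist G v x = enat n"
  proof (cases "gdist G v x")
    case infinity
    then show thesis using *(1) by (simp add: numeral_eq_enat)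
  qed
  then have "2 * n \<le> r" using *(1) by (simp add: numeral_eq_enat)
  then show thesis using that n gdist_pow[OF n] * by blast
qed

lemma ball_halfI:
  assumes "simple_graph G" "v \<in> verts G" "(adj G ^^ n) v x" "2 * n \<le> r"
  shows "x \<in> verts (ball_half G v r)"
proof -
  have "2 * gdist G v x \<le> 2 * enat n" using gdist_le[OF assms(1-3)] by (rule mult_left_mono) simp
  also have "\<dots> \<le> enat r" using assms(4) by (simp add: numeral_eq_enat)
  finally show ?thesis using adj_pow_verts[OF assms(1-3)] by (simp add: ball_half_def)
qed

lemma covering_ball:
  assumes "covering H G p" "v \<in> verts H" "x \<in> verts (ball_half H v r)"
  shows "p x \<in> verts (ball_half G (p v) r)"
  using assms covering_pow[OF assms(1)] covering_verts[OF assms(1,2)]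
  by (metis ball_halfE ball_halfI covering_def)

lemma ball_preservingI:
  assumes cov: "covering H G p"
    and inj: "\<And>v x y. v \<in> verts H \<Longrightarrow> x \<in> verts (ball_half H v r) \<Longrightarrow> y \<in> verts (ball_half H v r) \<Longrightarrow>
       p x = p y \<Longrightarrow> x = y"
    and edge: "\<And>v x y. v \<in> verts H \<Longrightarrow> x \<in> verts (ball_half H v r) \<Longrightarrow> y \<in> verts (ball_half H v r) \<Longrightarrow>
       {p x, p y} \<in> edges (ball_half G (p v) r) \<Longrightarrow> adj H x y"
  shows "ball_preserving r H G p"
  unfolding ball_preserving_def graph_iso_def
proof (intro ballI conjI)
  fix v assume v: "v \<in> verts H"
  have sH: "simple_graph H" and sG: "simple_graph G" using cov by (auto simp: covering_def)
  show "bij_betw p (verts (ball_half H v r)) (verts (ball_half G (p v) r))" unfolding bij_betw_def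
  proof (intro conjI inj_onI equalityI subsetI)
    fix b assume "b \<in> verts (ball_half G (p v) r)"
    then obtain n where n: "(adj G ^^ n) (p v) b" "2 * n \<le> r" by (rule ball_halfE)
    then obtain y where "(adj H ^^ n) v y" "p y = b" using covering_lift_pow[OF cov v] by blast
    then show "b \<in> p ` verts (ball_half H v r)" using ball_halfI[OF sH v] n(2) by blast
  qed (use inj[OF v] covering_ball[OF cov v] in auto)
  have dist: "gdist H v x = gdist G (p v) (p x)" if x: "x \<in> verts (ball_half H v r)" for x
  proof (rule antisym)
    obtain n where n: "gdist G (p v) (p x) = enat n" "(adj G ^^ n) (p v) (p x)" "2 * n \<le> r"
      using covering_ball[OF cov v x] by (rule ball_halfE)
    then obtain y where y: "(adj H ^^ n) v y" "p y = p x" using covering_lift_pow[OF cov v] by blast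
    then have "y = x" using inj[OF v ball_halfI[OF sH v y(1) n(3)] x] by simp
    then show "gdist H v x \<le> gdist G (p v) (p x)" using n gdist_le[OF sH v] y(1) by simp
    obtain m where "gdist H v x = enat m" "(adj H ^^ m) v x" using x by (rule ball_halfE)
    then show "gdist G (p v) (p x) \<le> gdist H v x"
      using gdist_le[OF sG covering_verts[OF cov v]] covering_pow[OF cov] by metis
  qed
  fix x y assume x: "x \<in> verts (ball_half H v r)" and y: "y \<in> verts (ball_half H v r)"
  have no_loop: "{a} \<notin> edges (ball_half K w r)" if "simple_graph K" for K :: "'c graph" and a w
    using that by (auto simp: ball_half_def simple_graph_def)
  show "{x, y} \<in> edges (ball_half H v r) \<longleftrightarrow> {p x, p y} \<in> edges (ball_half G (p v) r)"
  proof (cases "x = y")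
    case True
    then show ?thesis using sH sG by (auto simp: ball_half_def simple_graph_def)
  next
    case False
    then have "p x \<noteq> p y" using inj[OF v x y] by blast
    then show ?thesis using False edge[OF v x y] covering_hom[OF cov] dist x y
      by (metis ball_half_edge)
  qed
qed

lemma ball_preservingD:
  assumes "ball_preserving r H G p" "v \<in> verts H"
    and "x \<in> verts (ball_half H v r)" "y \<in> verts (ball_half H v r)"
  shows "p x = p y \<Longrightarrow> x = y" "{p x, p y} \<in> edges (ball_half G (p v) r) \<Longrightarrow> adj H x y"
proof -
  have *: "graph_iso (ball_half H v r) (ball_half G (p v) r) p"
    using assms by (auto simp: ball_preserving_def)
  show "p x = p y \<Longrightarrow> x = y" using * assms unfolding graph_iso_def by (meson bij_betw_def inj_onD)
  assume "{p x, p y} \<in> edges (ball_half G (p v) r)"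
  then have "{x, y} \<in> edges (ball_half H v r)" using * assms unfolding graph_iso_def by blast
  then show "adj H x y" by (simp add: ball_half_def adj_def)
qed

lemma walk_lift_unique:
  assumes "covering H G p"
  shows "walk H xs \<Longrightarrow> walk H ys \<Longrightarrow> hd xs = hd ys \<Longrightarrow> map p xs = map p ys \<Longrightarrow> xs = ys"
proof (induction xs arbitrary: ys)
  case (Cons x xs)
  from Cons.prems obtain ys' where ys: "ys = x # ys'" by (cases ys) auto
  show ?case
  proof (cases xs)
    case Nil
    then show ?thesis using Cons.prems ys by simp
  next
    case (Cons a as)
    then obtain b bs where b: "ys' = b # bs" using Cons.prems(4) ys by (cases ys') auto
    then have "a = b" using Cons.prems Cons ys covering_inj[OF assms, of x a b]
      by (auto simp: walk_Cons)
    then show ?thesis using Cons.IH[of ys'] Cons.prems Cons ys b by (auto simp: walk_Cons)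
  qed
qed (simp add: walk_def)

text \<open>Every covering of \<open>G\<close> can be relabelled by walks in \<open>G\<close>.\<close>

lemma covering_label:
  fixes H :: "'b graph" and G :: "'a graph"
  assumes cov: "covering H G p"
  obtains f :: "'b \<Rightarrow> 'a list" where "inj_on f (verts H)"
proof -
  have sH: "simple_graph H" using cov by (auto simp: covering_def)
  define root where "root a = (SOME z. z \<in> verts H \<and> (adj G)\<^sup>*\<^sup>* (p z) a)" for a
  have root: "root (p x) \<in> verts H \<and> (adj G)\<^sup>*\<^sup>* (p (root (p x))) (p x)" if "x \<in> verts H" for x
    unfolding root_def by (rule someI[of _ x]) (use that in auto)
  have root_eq: "root a = root b" if "(adj G)\<^sup>*\<^sup>* a b" for a b
  proof -
    have "(adj G)\<^sup>*\<^sup>* z a \<longleftrightarrow> (adj G)\<^sup>*\<^sup>* z b" for z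
      using that adj_rtranclp_sym by (meson rtranclp_trans)
    then show ?thesis by (simp add: root_def)
  qed
  define w where "w x = (SOME vs. walk_betw H (root (p x)) vs x)" for x
  have w: "walk_betw H (root (p x)) (w x) x" if x: "x \<in> verts H" for x
  proof -
    have "(adj H)\<^sup>*\<^sup>* (root (p x)) x" using root[OF x] x cov by (auto simp: covering_iff)
    then have "\<exists>vs. walk_betw H (root (p x)) vs x" using root[OF x] walk_betw_iff[OF sH] by blast
    then show ?thesis unfolding w_def by (rule someI_ex)
  qed
  have "inj_on (\<lambda>x. map p (w x)) (verts H)"
  proof (rule inj_onI)
    fix x y assume x: "x \<in> verts H" and y: "y \<in> verts H" and eq: "map p (w x) = map p (w y)"
    have ne: "w x \<noteq> []" "w y \<noteq> []" using w[OF x] w[OF y] by (auto simp: walk_betw_def walk_def)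
    then have "p (last (w x)) = p (last (w y))" using eq by (metis last_map)
    then have "p x = p y" using w[OF x] w[OF y] by (simp add: walk_betw_def)
    then have "hd (w x) = hd (w y)" using w[OF x] w[OF y] by (simp add: walk_betw_def)
    then have "w x = w y"
      using walk_lift_unique[OF cov] eq w[OF x] w[OF y] by (auto simp: walk_betw_def)
    then show "x = y" using w[OF x] w[OF y] by (auto simp: walk_betw_def)
  qed
  then show thesis by (rule that)
qed

lemma relabel:
  fixes H :: "'b graph" and G :: "'a graph"
  assumes cov: "covering H G p" and bp: "ball_preserving r H G p"
  obtains H' :: "'a list graph" and g where "covering H' G (p \<circ> g)" "ball_preserving r H' G (p \<circ> g)"
    "covering H' H g"
proof -
  obtain f :: "'b \<Rightarrow> 'a list" where inj: "inj_on f (verts H)" using covering_label[OF cov] .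
  define H' where "H' = Graph (f ` verts H) ((\<lambda>e. f ` e) ` edges H)"
  define g where "g = inv_into (verts H) f"
  have sH: "simple_graph H" and sG: "simple_graph G" using cov by (auto simp: covering_def)
  have gf: "g (f x) = x" if "x \<in> verts H" for x using that inj by (simp add: g_def)
  have sH': "simple_graph H'"
    using sH inj by (auto simp: simple_graph_def H'_def card_image inj_on_subset)
  have adj': "adj H' x y \<longleftrightarrow> (\<exists>a b. x = f a \<and> y = f b \<and> adj H a b)" for x y
  proof
    assume "adj H' x y"
    then obtain e where e: "e \<in> edges H" "{x, y} = f ` e" by (auto simp: adj_def H'_def)
    then obtain a where a: "a \<in> e" "x = f a" by blast
    then obtain b where b: "e = {a, b}" "adj H a b" using edge_obtain[OF sH e(1)] by blast
    then have "y = f b" using e(2) a by (auto simp: doubleton_eq_iff)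
    then show "\<exists>a b. x = f a \<and> y = f b \<and> adj H a b" using a b by blast
  next
    assume "\<exists>a b. x = f a \<and> y = f b \<and> adj H a b"
    then obtain a b where ab: "x = f a" "y = f b" "{a, b} \<in> edges H" by (auto simp: adj_def)
    then have "{x, y} = f ` {a, b}" by simp
    then show "adj H' x y" using ab(3) unfolding adj_def H'_def graph.sel by blast
  qed
  have hom: "adj H (g x) (g y)" if "adj H' x y" for x y
    using that adj' gf adj_verts[OF sH] by metis
  have fadj: "adj H' (f a) (f b)" if "adj H a b" for a b using that adj' by blast
  have gv: "g x \<in> verts H" "f (g x) = x" if "x \<in> verts H'" for x using that gf by (auto simp: H'_def)
  have fv: "f a \<in> verts H'" if "a \<in> verts H" for a using that by (auto simp: H'_def)
  have reach: "(adj H')\<^sup>*\<^sup>* (f a) (f b)" if "(adj H)\<^sup>*\<^sup>* a b" for a b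
    using that by (induction rule: rtranclp_induct) (auto intro: rtranclp.rtrancl_into_rtrancl fadj)
  have c1: "covering H' G (p \<circ> g)" unfolding covering_iff
  proof (intro conjI ballI allI impI)
    have "g ` verts H' = verts H" using gf by (auto simp: H'_def image_image)
    then show "(p \<circ> g) ` verts H' = verts G" using cov by (metis covering_iff image_comp)
    show "adj G ((p \<circ> g) x) ((p \<circ> g) y)" if "adj H' x y" for x y
      using hom[OF that] covering_hom[OF cov] by simp
    fix x assume x: "x \<in> verts H'"
    show "\<exists>!y. adj H' x y \<and> (p \<circ> g) y = b" if b: "adj G ((p \<circ> g) x) b" for b
    proof (rule ex_ex1I)
      obtain y where y: "adj H (g x) y" "p y = b"
        using covering_lift[OF cov gv(1)[OF x]] b by auto
      then have "adj H' x (f y)" using fadj[OF y(1)] gv[OF x] by simp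
      moreover have "g (f y) = y" using gf adj_verts[OF sH y(1)] by blast
      ultimately show "\<exists>y. adj H' x y \<and> (p \<circ> g) y = b" using y by auto
      fix y z assume *: "adj H' x y \<and> (p \<circ> g) y = b" "adj H' x z \<and> (p \<circ> g) z = b"
      then have "g y = g z" using covering_inj[OF cov, of "g x" "g y" "g z"] hom by auto
      then show "y = z" using gv(2) * adj_verts[OF sH'] by metis
    qed
    show "(adj H')\<^sup>*\<^sup>* x y" if y: "y \<in> verts H'" and *: "(adj G)\<^sup>*\<^sup>* ((p \<circ> g) x) ((p \<circ> g) y)" for y
    proof -
      have "(adj H)\<^sup>*\<^sup>* (g x) (g y)" using cov * gv x y by (auto simp: covering_iff)
      then show ?thesis using reach[of "g x" "g y"] gv x y by simp
    qed
  qed (fact sH' sG)+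
  have c2: "covering H' H g" by (rule covering_factor[OF c1 cov]) (auto intro: hom gv)
  have "ball_preserving r H' G (p \<circ> g)"
  proof (rule ball_preservingI[OF c1])
    fix v x y assume v: "v \<in> verts H'" and x: "x \<in> verts (ball_half H' v r)"
      and y: "y \<in> verts (ball_half H' v r)"
    have xy: "x \<in> verts H'" "y \<in> verts H'" using x y by (auto simp: ball_half_def)
    note D = ball_preservingD[OF bp gv(1)[OF v] covering_ball[OF c2 v x] covering_ball[OF c2 v y]]
    show "x = y" if "(p \<circ> g) x = (p \<circ> g) y" using D(1) that gv(2) xy by (metis comp_apply)
    show "adj H' x y" if "{(p \<circ> g) x, (p \<circ> g) y} \<in> edges (ball_half G ((p \<circ> g) v) r)"
      using fadj[OF D(2)] that gv(2) xy by simp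
  qed
  then show thesis using that c1 c2 by blast
qed

theorem local_covering_universal:
  fixes H :: "'c graph"
  assumes loc: "local_covering r Gr G pr"
    and cov: "covering H G p" and bp: "ball_preserving r H G p"
  shows "\<exists>q. covering Gr H q \<and> (\<forall>x\<in>verts Gr. pr x = p (q x))"
proof -
  obtain H' :: "'b list graph" and g where H': "covering H' G (p \<circ> g)"
    "ball_preserving r H' G (p \<circ> g)" "covering H' H g" using relabel[OF cov bp] .
  then obtain q where q: "covering Gr H' q" "\<forall>x\<in>verts Gr. pr x = (p \<circ> g) (q x)"
    using loc unfolding local_covering_def by blast
  have "covering Gr H (g \<circ> q)"
  proof (rule covering_factor[OF _ cov])
    show "covering Gr G pr" using loc by (simp add: local_covering_def)
    show "(g \<circ> q) x \<in> verts H" if "x \<in> verts Gr" for x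
      using covering_verts[OF H'(3) covering_verts[OF q(1) that]] by simp
    show "adj H ((g \<circ> q) x) ((g \<circ> q) y)" if "adj Gr x y" for x y
      using covering_hom[OF H'(3) covering_hom[OF q(1) that]] by simp
    show "pr x = p ((g \<circ> q) x)" if "x \<in> verts Gr" for x
      using q(2) that by simp
  qed
  then show ?thesis using q(2) by (intro exI[of _ "g \<circ> q"]) auto
qed

text \<open>Existence: the fibre product of all ball-preserving coverings, restricted to one component
  over each component of \<open>G\<close>.\<close>

theorem local_covering_exists:
  fixes G :: "'a graph"
  assumes sG: "simple_graph G"
  shows "\<exists>(Gr :: 'a list graph) pr. local_covering r Gr G pr"
proof -
  define I where "I = {(H :: 'a list graph, p). covering H G p \<and> ball_preserving r H G p}"
  have I: "covering (fst i) G (snd i)" "ball_preserving r (fst i) G (snd i)" if "i \<in> I" for i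
    using that by (auto simp: I_def)
  define W where "W = {x. fst x \<in> verts G \<and>
     (\<forall>i\<in>I. snd x i \<in> verts (fst i) \<and> snd i (snd x i) = fst x) \<and>
     (\<forall>i\<in>-I. snd x i = undefined)}"
  define A where "A x y \<longleftrightarrow> x \<in> W \<and> y \<in> W \<and> adj G (fst x) (fst y) \<and>
     (\<forall>i\<in>I. adj (fst i) (snd x i) (snd y i))" for x y
  have A_sym: "A x y \<Longrightarrow> A y x" for x y by (auto simp: A_def intro: adj_sym)
  have W: "snd x i \<in> verts (fst i)" "snd i (snd x i) = fst x" if "x \<in> W" "i \<in> I" for x i
    using that unfolding W_def by blast+
  have W_fst: "fst x \<in> verts G" if "x \<in> W" for x using that unfolding W_def by blast
  have W_eq: "x = y" if "x \<in> W" "y \<in> W" "fst x = fst y" "\<And>i. i \<in> I \<Longrightarrow> snd x i = snd y i" for x y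
  proof (rule prod_eqI[OF that(3)], rule ext)
    fix i show "snd x i = snd y i"
      using that unfolding W_def by (cases "i \<in> I") simp_all
  qed
  have W_ex: "\<exists>x\<in>W. fst x = a" if a: "a \<in> verts G" for a
  proof -
    have "\<exists>z. z \<in> verts (fst i) \<and> snd i z = a" if "i \<in> I" for i
      using covering_surj[OF I(1)[OF that] a] by blast
    then obtain f where "\<And>i. i \<in> I \<Longrightarrow> f i \<in> verts (fst i) \<and> snd i (f i) = a" by metis
    then have "(a, \<lambda>i. if i \<in> I then f i else undefined) \<in> W" using a unfolding W_def by simp
    then show ?thesis by force
  qed
  have A_lift: "\<exists>y. A x y \<and> fst y = b" if x: "x \<in> W" and b: "adj G (fst x) b" for x b
  proof -
    have "\<exists>z. adj (fst i) (snd x i) z \<and> snd i z = b" if "i \<in> I" for i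
      using covering_lift[OF I(1)[OF that] W(1)[OF x that]] W(2)[OF x that] b by simp
    then obtain f where f: "\<And>i. i \<in> I \<Longrightarrow> adj (fst i) (snd x i) (f i) \<and> snd i (f i) = b" by metis
    let ?y = "(b, \<lambda>i. if i \<in> I then f i else undefined)"
    have "f i \<in> verts (fst i)" if "i \<in> I" for i
      using f[OF that] I(1)[OF that] adj_verts by (metis covering_def)
    then have "?y \<in> W" using f adj_verts[OF sG b] unfolding W_def by simp
    then have "A x ?y" using x b f unfolding A_def by simp
    then show ?thesis by force
  qed
  have A_inj: "y = z" if "A x y" "A x z" "fst y = fst z" for x y z
  proof (rule W_eq)
    fix i assume i: "i \<in> I"
    show "snd y i = snd z i"
      by (rule covering_inj[OF I(1)[OF i], of "snd x i"]) (use that i W in \<open>auto simp: A_def\<close>)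
  qed (use that in \<open>auto simp: A_def\<close>)
  define root where "root a = (SOME x. x \<in> W \<and> (adj G)\<^sup>*\<^sup>* (fst x) a)" for a
  have root: "root a \<in> W \<and> (adj G)\<^sup>*\<^sup>* (fst (root a)) a" if "a \<in> verts G" for a
    unfolding root_def by (rule someI_ex) (use W_ex[OF that] in blast)
  have root_eq: "root a = root b" if "(adj G)\<^sup>*\<^sup>* a b" for a b
  proof -
    have "(adj G)\<^sup>*\<^sup>* z a \<longleftrightarrow> (adj G)\<^sup>*\<^sup>* z b" for z
      using that adj_rtranclp_sym by (meson rtranclp_trans)
    then show ?thesis by (simp add: root_def)
  qed
  define V where "V = {x \<in> W. A\<^sup>*\<^sup>* (root (fst x)) x}"
  define P where "P = Graph V {{x, y} | x y. x \<in> V \<and> A x y}"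
  have V_step: "y \<in> V" if "x \<in> V" "A x y" for x y
  proof -
    have "root (fst x) = root (fst y)" using root_eq that(2) by (auto simp: A_def)
    then have "A\<^sup>*\<^sup>* (root (fst y)) x" "y \<in> W" using that by (auto simp: V_def A_def)
    then show ?thesis using that(2) by (simp add: V_def rtranclp.rtrancl_into_rtrancl)
  qed
  have aP: "adj P x y \<longleftrightarrow> x \<in> V \<and> A x y" for x y
  proof
    assume "adj P x y"
    then obtain x' y' where "{x, y} = {x', y'}" "x' \<in> V" "A x' y'"
      unfolding adj_def P_def graph.sel by blast
    then show "x \<in> V \<and> A x y" using V_step A_sym by (metis doubleton_eq_iff)
  next
    assume "x \<in> V \<and> A x y"
    then show "adj P x y" unfolding adj_def P_def graph.sel by blast
  qed
  have vP: "verts P = V" by (simp add: P_def)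
  have sP: "simple_graph P" unfolding simple_graph_def
  proof
    fix e assume "e \<in> edges P"
    then obtain x y where e: "e = {x, y}" "x \<in> V" "A x y" by (auto simp: P_def)
    have "x \<noteq> y" using e(3) adj_verts[OF sG] by (auto simp: A_def)
    then show "e \<subseteq> verts P \<and> card e = 2" using e V_step vP by auto
  qed
  have V_reach: "y \<in> V \<and> (adj P)\<^sup>*\<^sup>* x y" if "A\<^sup>*\<^sup>* x y" "x \<in> V" for x y
    using that
  proof (induction rule: rtranclp_induct)
    case (step y z)
    then show ?case using V_step aP by (meson rtranclp.rtrancl_into_rtrancl)
  qed auto
  have root_V: "root a \<in> V" if "a \<in> verts G" for a
    using root[OF that] root_eq[of "fst (root a)" a] by (simp add: V_def)
  have V_surj: "\<exists>x\<in>V. fst x = b" if b: "b \<in> verts G" for b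
  proof -
    have "(adj G)\<^sup>*\<^sup>* (fst (root b)) b" using root[OF b] by blast
    then show ?thesis
    proof (induction rule: rtranclp_induct)
      case (step y z)
      then obtain x where x: "x \<in> V" "fst x = y" by blast
      then obtain x' where "A x x'" "fst x' = z" using A_lift[of x z] step(2) by (auto simp: V_def)
      then show ?case using V_step[OF x(1)] by blast
    qed (use root_V[OF b] in blast)
  qed
  have covP: "covering P G fst" unfolding covering_iff
  proof (intro conjI ballI allI impI)
    show "fst ` verts P = verts G" using V_surj W_fst by (force simp: vP V_def)
    show "adj G (fst x) (fst y)" if "adj P x y" for x y using that by (simp add: aP A_def)
    fix x assume x: "x \<in> verts P"
    show "\<exists>!y. adj P x y \<and> fst y = b" if "adj G (fst x) b" for b
      using A_lift[OF _ that] A_inj x unfolding vP aP V_def by blast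
    show "(adj P)\<^sup>*\<^sup>* x y" if y: "y \<in> verts P" and xy: "(adj G)\<^sup>*\<^sup>* (fst x) (fst y)" for y
    proof -
      let ?z = "root (fst x)"
      have z: "?z \<in> V" using root_V W_fst x by (auto simp: vP V_def)
      have "(adj P)\<^sup>*\<^sup>* ?z x" using V_reach[OF _ z] x by (auto simp: vP V_def)
      moreover have "(adj P)\<^sup>*\<^sup>* ?z y"
        using V_reach[OF _ z] y root_eq[OF xy] by (auto simp: vP V_def)
      ultimately show ?thesis by (meson adj_rtranclp_sym rtranclp_trans)
    qed
  qed (fact sP sG)+
  have proj: "covering P (fst i) (\<lambda>x. snd x i)" if i: "i \<in> I" for i
    by (rule covering_factor[OF covP I(1)[OF i]]) (use W i in \<open>auto simp: vP aP V_def A_def\<close>)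
  have bpP: "ball_preserving r P G fst"
  proof (rule ball_preservingI[OF covP])
    fix v x y assume v: "v \<in> verts P" and x: "x \<in> verts (ball_half P v r)"
      and y: "y \<in> verts (ball_half P v r)"
    have xy: "x \<in> V" "y \<in> V" using x y vP by (auto simp: ball_half_def)
    then have xyW: "x \<in> W" "y \<in> W" by (auto simp: V_def)
    have vW: "v \<in> W" using v by (auto simp: vP V_def)
    note D = ball_preservingD[OF I(2) covering_verts[OF proj v] covering_ball[OF proj v x]
        covering_ball[OF proj v y]]
    show "x = y" if "fst x = fst y"
      by (rule W_eq) (use that xyW D(1) W(2) in auto)
    show "adj P x y" if e: "{fst x, fst y} \<in> edges (ball_half G (fst v) r)"
    proof -
      have "adj G (fst x) (fst y)" using e by (simp add: ball_half_def adj_def)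
      moreover have "adj (fst i) (snd x i) (snd y i)" if i: "i \<in> I" for i
        using D(2)[OF i i i i] e W(2)[OF xyW(1) i] W(2)[OF xyW(2) i] W(2)[OF vW i] by simp
      ultimately show ?thesis using xy xyW by (simp add: aP A_def)
    qed
  qed
  obtain Gr :: "'a list graph" and g where Gr: "covering Gr G (fst \<circ> g)"
    "ball_preserving r Gr G (fst \<circ> g)" "covering Gr P g" using relabel[OF covP bpP] .
  have "local_covering r Gr G (fst \<circ> g)" unfolding local_covering_def
  proof (intro conjI allI impI Gr(1,2))
    fix H :: "'a list graph" and p
    assume Hp: "covering H G p \<and> ball_preserving r H G p"
    then have i: "(H, p) \<in> I" by (simp add: I_def)
    let ?q = "\<lambda>x. snd (g x) (H, p)"
    have eq: "(fst \<circ> g) x = p (?q x)" if "x \<in> verts Gr" for x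
      using W(2)[OF _ i, of "g x"] covering_verts[OF Gr(3) that] by (simp add: vP V_def)
    have "covering Gr H ?q"
    proof (rule covering_factor[OF Gr(1)])
      show "covering H G p" using Hp by blast
      show "?q x \<in> verts H" if "x \<in> verts Gr" for x
        using covering_verts[OF proj[OF i] covering_verts[OF Gr(3) that]] by simp
      show "adj H (?q x) (?q y)" if "adj Gr x y" for x y
        using covering_hom[OF proj[OF i] covering_hom[OF Gr(3) that]] by simp
    qed (rule eq)
    then show "\<exists>q. covering Gr H q \<and> (\<forall>x\<in>verts Gr. (fst \<circ> g) x = p (q x))" using eq by blast
  qed
  then show ?thesis by blast
qed

end

theory Submission
  imports Defs
begin

text \<open>
  We prove (3) \<open>\<Longrightarrow>\<close> (1) \<open>\<Longrightarrow>\<close> (2) \<open>\<Longrightarrow>\<close> (3). A cycle in a ball of \<open>G\<close> lifts through the ball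
  isomorphism to \<open>G\<^sub>r\<close>, and a cycle of length at most \<open>r\<close> lies in the ball of radius \<open>r/2\<close> around
  each of its vertices. For the last implication, a closed walk of length at most \<open>r\<close> in a graph
  of girth greater than \<open>r\<close> reduces to a point by cancelling backtracks, so its lifts to any
  covering are closed. Hence every covering of \<open>G\<close> is \<open>r/2\<close>-ball-preserving. In particular this
  holds for the universal covering of \<open>G\<close>, whose vertices are the non-backtracking walks from a
  root and which is a forest. By universality \<open>G\<^sub>r\<close> covers this forest, so it is a forest itself.
\<close>

section \<open>Walks and cycles\<close>

lemma walk_append:
  assumes "xs \<noteq> []" "ys \<noteq> []"
  shows "walk G (xs @ ys) \<longleftrightarrow> walk G xs \<and> walk G ys \<and> adj G (last xs) (hd ys)"
  using assms by (auto simp: walk_def adj_def successively_append_iff)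

lemma walk_map:
  assumes "\<And>x. x \<in> verts H \<Longrightarrow> p x \<in> verts G" "\<And>x y. adj H x y \<Longrightarrow> adj G (p x) (p y)"
  shows "walk H vs \<Longrightarrow> walk G (map p vs)"
proof (induction vs)
  case (Cons x xs)
  then show ?case using assms by (cases xs) (auto simp: walk_Cons)
qed (simp add: walk_def)

lemma adj_pow_sym: "(adj G ^^ n) x y \<Longrightarrow> (adj G ^^ n) y x"
proof (induction n arbitrary: y)
  case (Suc n)
  then obtain z where "(adj G ^^ n) x z" "adj G z y" by auto
  then show ?case using Suc.IH adj_sym by (metis relpowp_Suc_I2)
qed simp

lemma girth_greater_iff: "girth G > enat r \<longleftrightarrow> (\<forall>c. is_cycle G c \<longrightarrow> r < length c)"
proof
  assume g: "girth G > enat r"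
  show "\<forall>c. is_cycle G c \<longrightarrow> r < length c"
  proof (intro allI impI)
    fix c assume "is_cycle G c"
    then have "girth G \<le> enat (length c)" unfolding girth_def by (intro INF_lower) simp
    then show "r < length c" using g by (metis enat_ord_simps(2) less_le_trans)
  qed
next
  assume "\<forall>c. is_cycle G c \<longrightarrow> r < length c"
  \<comment> \<open>A bound by \<open>Suc r\<close> passes to the infimum, also over no cycles at
    all, and gives the strict inequality.\<close>
  then have "enat (Suc r) \<le> girth G" unfolding girth_def by (intro INF_greatest) (simp add: Suc_le_eq)
  then show "girth G > enat r" by (metis enat_ord_simps(2) lessI less_le_trans)
qed

lemma is_cycle_closed_walk: "is_cycle G c \<Longrightarrow> walk G (c @ [hd c])"
  by (subst walk_append) (auto simp: is_cycle_def adj_def walk_def)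

lemma is_cycle_subgraph:
  assumes "verts G \<subseteq> verts H" "edges G \<subseteq> edges H" "is_cycle G c"
  shows "is_cycle H c"
  using assms successively_mono[of "\<lambda>x y. {x, y} \<in> edges G" c "\<lambda>x y. {x, y} \<in> edges H"]
  by (auto simp: is_cycle_def walk_def)

text \<open>Used to refute cycles through an extremal vertex, which can have only one candidate
  neighbour.\<close>

lemma is_cycle_neighbours:
  assumes "is_cycle G c" "x \<in> set c"
  obtains y z where "y \<in> set c" "z \<in> set c" "y \<noteq> z" "adj G x y" "adj G x z"
proof -
  let ?n = "length c"
  have n: "3 \<le> ?n" and d: "distinct c" and w: "walk G c" and e: "adj G (last c) (hd c)"
    using assms by (auto simp: is_cycle_def adj_def)
  have ne: "c \<noteq> []" using n by auto
  have step: "adj G (c ! j) (c ! Suc j)" if "Suc j < ?n" for j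
    using w that by (auto simp: walk_def adj_def successively_conv_nth)
  have close: "adj G (c ! (?n - 1)) (c ! 0)" using e ne by (simp add: last_conv_nth hd_conv_nth)
  obtain i where i: "i < ?n" "x = c ! i" using assms(2) by (auto simp: in_set_conv_nth)
  \<comment> \<open>The cyclic successor and predecessor of position \<open>i\<close>; they differ
    because the length is at least 3.\<close>
  define s where "s = (if Suc i < ?n then Suc i else 0)"
  define t where "t = (if i = 0 then ?n - 1 else i - 1)"
  have st: "s < ?n" "t < ?n" "s \<noteq> t" using n i by (auto simp: s_def t_def)
  have "adj G x (c ! s)"
  proof (cases "Suc i < ?n")
    case False
    then have "i = ?n - 1" using i by simp
    then show ?thesis using close i False by (simp add: s_def)
  qed (use step i in \<open>simp add: s_def\<close>)
  moreover have "adj G x (c ! t)"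
    using close step[of "i - 1"] i by (cases "i = 0") (auto simp: t_def intro: adj_sym)
  moreover have "c ! s \<noteq> c ! t" using st d by (simp add: nth_eq_iff_index_eq)
  ultimately show thesis using that[of "c ! s" "c ! t"] st by simp
qed

text \<open>The inverse bijection carries a cycle of \<open>H\<close> back to \<open>G\<close>: all
  its vertices lie in \<open>verts H\<close>, where \<open>graph_iso\<close> controls the
  edges.\<close>

lemma graph_iso_acyclic:
  assumes iso: "graph_iso G H f" and ac: "acyclic_graph G"
  shows "acyclic_graph H"
  unfolding acyclic_graph_def
proof
  assume "\<exists>c. is_cycle H c"
  then obtain c where c: "is_cycle H c" by blast
  define g where "g = inv_into (verts G) f"
  have bij: "bij_betw f (verts G) (verts H)" using iso by (simp add: graph_iso_def)
  have g: "g y \<in> verts G" "f (g y) = y" if "y \<in> verts H" for y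
    using that bij unfolding g_def bij_betw_def by (auto simp: inv_into_into f_inv_into_f)
  have sub: "set c \<subseteq> verts H" and ne: "c \<noteq> []" using c by (auto simp: is_cycle_def walk_def)
  have edge: "{g x, g y} \<in> edges G" if "x \<in> set c" "y \<in> set c" "{x, y} \<in> edges H" for x y
    using iso that sub g unfolding graph_iso_def by (metis subsetD)
  have inj: "inj_on g (set c)" by (metis g(2) inj_onI sub subsetD)
  have "successively (\<lambda>x y. {x, y} \<in> edges G) (map g c)"
    using c unfolding successively_map is_cycle_def walk_def
    by (elim conjE successively_mono) (rule edge)
  moreover have "{last (map g c), hd (map g c)} \<in> edges G"
    using c ne edge[of "last c" "hd c"] by (simp add: last_map hd_map is_cycle_def)
  ultimately have "is_cycle G (map g c)"
    using c sub g(1) ne inj by (auto simp: is_cycle_def walk_def distinct_map)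
  then show False using ac by (auto simp: acyclic_graph_def)
qed

section \<open>Non-backtracking walks\<close>

fun nonbacktracking :: "'a list \<Rightarrow> bool" where
  "nonbacktracking (a # b # c # xs) \<longleftrightarrow> a \<noteq> c \<and> nonbacktracking (b # c # xs)"
| "nonbacktracking _ \<longleftrightarrow> True"

lemma nonbacktracking_tl: "nonbacktracking xs \<Longrightarrow> nonbacktracking (tl xs)"
  by (induction xs rule: nonbacktracking.induct) auto

lemma backtrack_obtain:
  assumes "\<not> nonbacktracking vs"
  obtains xs a b ys where "vs = xs @ [a, b, a] @ ys"
proof -
  have "\<exists>xs a b ys. vs = xs @ [a, b, a] @ ys" using assms
  proof (induction vs rule: nonbacktracking.induct)
    case (1 a b c xs)
    show ?case
    proof (cases "a = c")
      case True
      then show ?thesis by (intro exI[of _ "[]"]) simp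
    next
      case False
      then obtain us d e ys where "b # c # xs = us @ [d, e, d] @ ys" using 1 by auto
      then show ?thesis by (intro exI[of _ "a # us"]) auto
    qed
  qed auto
  then show thesis using that by blast
qed

text \<open>In the shortest suffix with a repeated vertex, the first vertex \<open>x\<close> recurs,
  and the stretch before the recurrence is a cycle. It has at least 3 vertices: there are no loops,
  and \<open>x, a, x\<close> would backtrack.\<close>

lemma nonbacktracking_walk_cycle:
  assumes "simple_graph G"
  shows "walk G vs \<Longrightarrow> nonbacktracking vs \<Longrightarrow> \<not> distinct vs \<Longrightarrow>
    \<exists>c. is_cycle G c \<and> length c < length vs"
proof (induction vs)
  case (Cons x xs)
  show ?case
  proof (cases "distinct xs")
    case False
    have "nonbacktracking xs" "walk G xs"
      using nonbacktracking_tl[OF Cons.prems(2)] Cons.prems False by (auto simp: walk_Cons)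
    then show ?thesis using Cons.IH False by fastforce
  next
    case True
    then obtain as bs where xs: "xs = as @ x # bs" using Cons.prems(3) by (auto dest: split_list)
    have w: "walk G ((x # as) @ x # bs)" using Cons.prems(1) xs by simp
    then have w': "walk G (x # as)" "adj G (last (x # as)) x"
      using walk_append[of "x # as" "x # bs" G] by auto
    have "as \<noteq> []" using w'(2) adj_verts[OF assms] by fastforce
    moreover have "as \<noteq> [a]" for a using Cons.prems(2) xs by auto
    ultimately have "2 \<le> length as" by (cases as; cases "tl as") auto
    then have "is_cycle G (x # as)" using w' True xs by (auto simp: is_cycle_def adj_def)
    then show ?thesis using xs by (intro exI[of _ "x # as"]) auto
  qed
qed simp

section \<open>Coverings of graphs of large girth\<close>

text \<open>A covering is injective on the neighbours of the middle vertex \<open>b\<close>.\<close>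

lemma covering_nonbacktracking:
  assumes cov: "covering H G p"
  shows "walk H vs \<Longrightarrow> nonbacktracking vs \<Longrightarrow> nonbacktracking (map p vs)"
proof (induction vs rule: nonbacktracking.induct)
  case (1 a b c xs)
  then have "adj H b a" "adj H b c" by (auto simp: walk_Cons intro: adj_sym)
  then have "p a \<noteq> p c" using covering_inj[OF cov, of b a c] 1(3) by auto
  then show ?case using 1 by (simp add: walk_Cons)
qed auto

text \<open>Induction on the length: the image is a closed walk too short to contain a cycle, so it
  backtracks. Then \<open>vs\<close> backtracks as well and can be shortened.\<close>

lemma covering_closed_walk_lift:
  assumes cov: "covering H G p" and girth: "\<And>c. is_cycle G c \<Longrightarrow> r < length c"
  shows "walk H vs \<Longrightarrow> length vs \<le> Suc r \<Longrightarrow> p (hd vs) = p (last vs) \<Longrightarrow> hd vs = last vs"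
proof (induction vs rule: length_induct)
  case (1 vs)
  have sG: "simple_graph G" using cov by (simp add: covering_def)
  have ne: "vs \<noteq> []" using 1 by (simp add: walk_def)
  show ?case
  proof (cases "tl vs = []")
    case True
    then show ?thesis using ne by (cases vs) auto
  next
    case False
    have w: "walk G (map p vs)"
      using walk_map[OF _ _ 1(2), of p G] covering_verts[OF cov] covering_hom[OF cov] by blast
    have "\<not> distinct (map p vs)" using False ne 1(4) by (cases vs) auto
    \<comment> \<open>A cycle found here has fewer than \<open>Suc r\<close> vertices, hence at most
      \<open>r\<close>.\<close>
    then have "\<not> nonbacktracking (map p vs)"
      using nonbacktracking_walk_cycle[OF sG w] girth 1(3) by fastforce
    then have "\<not> nonbacktracking vs" using covering_nonbacktracking[OF cov 1(2)] by blast
    then obtain xs u v ys where vs: "vs = xs @ [u, v, u] @ ys" by (rule backtrack_obtain)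
    have w3: "walk H ([u, v, u] @ ys)"
      using 1(2) vs walk_append[of xs "[u, v, u] @ ys"] by (cases "xs = []") auto
    \<comment> \<open>Cancelling \<open>u, v, u\<close> to \<open>u\<close> keeps both ends of the
      walk.\<close>
    have "walk H (u # ys)" using w3 by (simp add: walk_Cons)
    then have "walk H (xs @ u # ys)"
      using 1(2) vs walk_append[of xs "[u, v, u] @ ys"] walk_append[of xs "u # ys"]
      by (cases "xs = []") auto
    moreover have "hd (xs @ u # ys) = hd vs" "last (xs @ u # ys) = last vs"
      using vs by (auto simp: hd_append)
    ultimately show ?thesis using 1(1)[rule_format, of "xs @ u # ys"] 1(3,4) vs by simp
  qed
qed

lemma covering_closed_pow_lift:
  assumes cov: "covering H G p" and girth: "\<And>c. is_cycle G c \<Longrightarrow> r < length c"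
    and "x \<in> verts H" "(adj H ^^ n) x y" "n \<le> r" "p x = p y"
  shows "x = y"
proof -
  obtain vs where "walk_betw H x vs y" "length vs = Suc n"
    using pow_walk[of H x n y] assms by (auto simp: covering_def)
  then show ?thesis
    using covering_closed_walk_lift[OF cov girth, of vs] assms by (auto simp: walk_betw_def)
qed

text \<open>Two vertices of a ball are joined through its centre by a walk of length at most
  \<open>r\<close>, so equal images force equality. For edges, the strict bound on the distance sum
  leaves room for one more step.\<close>

lemma covering_large_girth_ball_preserving:
  assumes cov: "covering H G p" and girth: "\<And>c. is_cycle G c \<Longrightarrow> r < length c"
  shows "ball_preserving r H G p"
proof (rule ball_preservingI[OF cov])
  have sH: "simple_graph H" and sG: "simple_graph G" using cov by (auto simp: covering_def)
  note lift = covering_closed_pow_lift[OF cov girth]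
  fix v x y assume v: "v \<in> verts H" and x: "x \<in> verts (ball_half H v r)"
    and y: "y \<in> verts (ball_half H v r)"
  have inj: "x = y" if x: "x \<in> verts (ball_half H v r)" and y: "y \<in> verts (ball_half H v r)"
    and p: "p x = p y" for x y
  proof -
    obtain n where n: "2 * n \<le> r" "x \<in> verts H" "(adj H ^^ n) v x" using x by (rule ball_halfE)
    obtain m where m: "2 * m \<le> r" "(adj H ^^ m) v y" using y by (rule ball_halfE)
    have "(adj H ^^ (n + m)) x y" using adj_pow_sym[OF n(3)] m(2) by (auto simp: relpowp_add)
    then show "x = y" using lift[of x "n + m" y] n m p by simp
  qed
  then show "p x = p y \<Longrightarrow> x = y" using x y by blast
  \<comment> \<open>A shortest walk in \<open>G\<close> from \<open>p v\<close> to
    \<open>p x\<close> lifts to one ending at \<open>x\<close> itself, by injectivity on the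
    ball.\<close>
  have dist: "\<exists>n. gdist G (p v) (p x) = enat n \<and> (adj H ^^ n) v x"
    if x: "x \<in> verts (ball_half H v r)" for x
  proof -
    obtain n where n: "gdist G (p v) (p x) = enat n" "2 * n \<le> r" "(adj G ^^ n) (p v) (p x)"
      using covering_ball[OF cov v x] by (rule ball_halfE)
    then obtain z where z: "(adj H ^^ n) v z" "p z = p x" using covering_lift_pow[OF cov v] by blast
    then have "z = x" using inj[OF ball_halfI[OF sH v z(1) n(2)] x] by simp
    then show ?thesis using n z by blast
  qed
  assume e: "{p x, p y} \<in> edges (ball_half G (p v) r)"
  then have "p x \<noteq> p y" using sG by (auto simp: ball_half_def simple_graph_def)
  then have e': "adj G (p x) (p y)" "gdist G (p v) (p x) + gdist G (p v) (p y) < enat r"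
    using e by (simp_all add: ball_half_edge)
  obtain n where n: "gdist G (p v) (p x) = enat n" "(adj H ^^ n) v x" using dist[OF x] by blast
  obtain m where m: "gdist G (p v) (p y) = enat m" "(adj H ^^ m) v y" using dist[OF y] by blast
  have xH: "x \<in> verts H" using x by (simp add: ball_half_def)
  \<comment> \<open>The lift of the edge at \<open>x\<close> ends at some \<open>z\<close> over
    \<open>p y\<close>; the walk from \<open>z\<close> via \<open>x\<close> and \<open>v\<close> to
    \<open>y\<close> has length at most \<open>r\<close>, so \<open>z = y\<close>.\<close>
  obtain z where z: "adj H x z" "p z = p y" using covering_lift[OF cov xH e'(1)] by blast
  have "(adj H ^^ (n + m)) x y" using adj_pow_sym[OF n(2)] m(2) by (auto simp: relpowp_add)
  then have "(adj H ^^ Suc (n + m)) z y" using adj_sym[OF z(1)] by (rule relpowp_Suc_I2[rotated])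
  moreover have "Suc (n + m) \<le> r" using e'(2) n(1) m(1) by simp
  ultimately have "z = y" using lift z adj_verts[OF sH z(1)] by blast
  then show "adj H x y" using z by simp
qed

text \<open>A cycle maps to a closed walk in a forest, which must backtrack; then the cycle, closed
  up by its first vertex, backtracks too.\<close>

lemma covering_acyclic:
  assumes cov: "covering H G p" and ac: "acyclic_graph G"
  shows "acyclic_graph H"
  unfolding acyclic_graph_def
proof
  assume "\<exists>c. is_cycle H c"
  then obtain c where c: "is_cycle H c" by blast
  let ?w = "c @ [hd c]"
  have sG: "simple_graph G" using cov by (simp add: covering_def)
  have ne: "c \<noteq> []" and d: "distinct c" and n: "3 \<le> length c" using c by (auto simp: is_cycle_def)
  have w: "walk H ?w" using is_cycle_closed_walk[OF c] .
  have "walk G (map p ?w)"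
    using walk_map[OF _ _ w, of p G] covering_verts[OF cov] covering_hom[OF cov] by blast
  moreover have "\<not> distinct (map p ?w)" using ne by simp
  ultimately have "\<not> nonbacktracking (map p ?w)"
    using nonbacktracking_walk_cycle[OF sG] ac by (meson acyclic_graph_def)
  then have "\<not> nonbacktracking ?w" using covering_nonbacktracking[OF cov w] by blast
  then obtain xs u v ys where vs: "?w = xs @ [u, v, u] @ ys" by (rule backtrack_obtain)
  \<comment> \<open>If the backtrack ends at the closing vertex, then \<open>hd c = u\<close> is
    also the second to last vertex of \<open>c\<close>, which has length at least 3; otherwise
    \<open>u\<close> occurs twice inside \<open>c\<close>.\<close>
  show False
  proof (cases ys rule: rev_cases)
    case Nil
    then have c': "c = xs @ [u, v]" "hd c = u" using vs by auto
    then have "xs \<noteq> []" using n by auto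
    then show False using c' d by (cases xs) auto
  next
    case (snoc ys' z)
    then have "c = xs @ [u, v, u] @ ys'" using vs by simp
    then show False using d by simp
  qed
qed

section \<open>The universal covering\<close>

text \<open>A vertex is a non-backtracking walk from the root of its component, stored in reverse, so
  that the covering map is \<open>hd\<close> and an edge prepends one vertex.\<close>

definition comp_root :: "'a graph \<Rightarrow> 'a \<Rightarrow> 'a" where
  "comp_root G a = (SOME z. (adj G)\<^sup>*\<^sup>* z a)"

definition tree_verts :: "'a graph \<Rightarrow> 'a list set" where
  "tree_verts G = {vs. walk G vs \<and> nonbacktracking vs \<and> last vs = comp_root G (last vs)}"

definition tree_cover :: "'a graph \<Rightarrow> 'a list graph" where
  "tree_cover G = Graph (tree_verts G)
     {{vs, b # vs} | vs b. vs \<in> tree_verts G \<and> b # vs \<in> tree_verts G}"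

lemma comp_root: "(adj G)\<^sup>*\<^sup>* (comp_root G a) a"
  unfolding comp_root_def by (rule someI[of _ a]) simp

text \<open>Both choices are made from the same predicate, so each component gets a single
  root.\<close>

lemma comp_root_eq:
  assumes "(adj G)\<^sup>*\<^sup>* a b"
  shows "comp_root G a = comp_root G b"
proof -
  have "(adj G)\<^sup>*\<^sup>* z a \<longleftrightarrow> (adj G)\<^sup>*\<^sup>* z b" for z
    using assms adj_rtranclp_sym by (meson rtranclp_trans)
  then show ?thesis by (simp add: comp_root_def)
qed

lemma verts_tree_cover [simp]: "verts (tree_cover G) = tree_verts G"
  by (simp add: tree_cover_def)

lemma adj_tree_cover:
  "adj (tree_cover G) vs ws \<longleftrightarrow>
     vs \<in> tree_verts G \<and> ws \<in> tree_verts G \<and> ((\<exists>b. ws = b # vs) \<or> (\<exists>b. vs = b # ws))"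
  unfolding adj_def tree_cover_def graph.sel mem_Collect_eq doubleton_eq_iff by blast

lemma simple_tree_cover: "simple_graph (tree_cover G)"
  by (auto simp: simple_graph_def tree_cover_def)

lemma tree_verts_tl:
  assumes "a # vs \<in> tree_verts G" "vs \<noteq> []"
  shows "vs \<in> tree_verts G" "adj G a (hd vs)"
  using assms nonbacktracking_tl[of "a # vs"] by (auto simp: tree_verts_def walk_Cons)

lemma tree_cover_hom:
  assumes "adj (tree_cover G) vs ws"
  shows "adj G (hd vs) (hd ws)"
proof -
  have "vs \<noteq> []" "ws \<noteq> []" using assms by (auto simp: adj_tree_cover tree_verts_def walk_def)
  then show ?thesis using assms
    by (auto simp: adj_tree_cover dest: tree_verts_tl(2)[THEN adj_sym] tree_verts_tl(2))
qed

text \<open>If \<open>b\<close> is the vertex just before the end of the walk, then the step drops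
  the head, as prepending \<open>b\<close> would backtrack. Otherwise it prepends \<open>b\<close>,
  as dropping the head does not lead to \<open>b\<close>.\<close>

lemma tree_cover_lift:
  assumes sG: "simple_graph G" and vs: "vs \<in> tree_verts G" and b: "adj G (hd vs) b"
  shows "\<exists>!ws. adj (tree_cover G) vs ws \<and> hd ws = b"
proof -
  have ne: "vs \<noteq> []" and w: "walk G vs" using vs by (auto simp: tree_verts_def walk_def)
  have nil: "[] \<notin> tree_verts G" by (simp add: tree_verts_def walk_def)
  show ?thesis
  proof (cases "tl vs \<noteq> [] \<and> hd (tl vs) = b")
    case True
    then obtain a us where vs': "vs = a # b # us" by (cases vs; cases "tl vs") auto
    then have "b # us \<in> tree_verts G" using tree_verts_tl(1)[of a "b # us"] vs by simp
    moreover have "b # vs \<notin> tree_verts G" using vs' by (simp add: tree_verts_def)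
    ultimately show ?thesis using vs unfolding adj_tree_cover
      by (intro ex1I[of _ "b # us"]) (use vs' in simp, metis vs' list.sel(1,3))
  next
    case False
    have "nonbacktracking (b # vs)"
      using False vs by (cases vs; cases "tl vs") (auto simp: tree_verts_def)
    then have "b # vs \<in> tree_verts G"
      using vs ne w adj_sym[OF b] adj_verts[OF sG b] by (auto simp: tree_verts_def walk_Cons)
    then show ?thesis using vs False nil
      by (intro ex1I[of _ "b # vs"]) (auto simp: adj_tree_cover)
  qed
qed

text \<open>Removing heads one at a time leads to the trivial walk at the root. This gives the
  connectedness over each component.\<close>

lemma tree_verts_reach_root:
  "vs \<in> tree_verts G \<Longrightarrow> (adj (tree_cover G))\<^sup>*\<^sup>* vs [comp_root G (hd vs)]"
proof (induction vs)
  case (Cons a vs)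
  show ?case
  proof (cases "vs = []")
    case True
    then show ?thesis using Cons.prems by (auto simp: tree_verts_def)
  next
    case False
    note tl = tree_verts_tl[OF Cons.prems False]
    have "adj (tree_cover G) (a # vs) vs" using Cons.prems tl by (auto simp: adj_tree_cover)
    moreover have "comp_root G a = comp_root G (hd vs)" using comp_root_eq[OF r_into_rtranclp[of "adj G"]] tl(2) by simp
    ultimately show ?thesis using Cons.IH[OF tl(1)] by (simp add: converse_rtranclp_into_rtranclp)
  qed
qed (simp add: tree_verts_def walk_def)

text \<open>A walk from the root to \<open>a\<close> is lifted step by step.\<close>

lemma tree_cover_surj:
  assumes sG: "simple_graph G" and a: "a \<in> verts G"
  shows "\<exists>vs\<in>tree_verts G. hd vs = a"
  using comp_root[of G a]
proof (induction rule: rtranclp_induct)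
  case base
  have "comp_root G a \<in> verts G"
    using adj_rtranclp_verts[OF sG a] adj_rtranclp_sym[OF comp_root[of G a]] by simp
  then have "[comp_root G a] \<in> tree_verts G"
    using comp_root_eq[OF comp_root[of G a]] by (simp add: tree_verts_def walk_def)
  then show ?case by force
next
  case (step b c)
  then obtain vs where "vs \<in> tree_verts G" "hd vs = b" by blast
  then show ?case using tree_cover_lift[OF sG] step(2) by (metis adj_tree_cover)
qed

lemma covering_tree_cover:
  assumes sG: "simple_graph G"
  shows "covering (tree_cover G) G hd"
  unfolding covering_iff
proof (intro conjI ballI allI impI)
  show "hd ` verts (tree_cover G) = verts G"
    using tree_cover_surj[OF sG] by (force simp: tree_verts_def walk_def)
  show "(adj (tree_cover G))\<^sup>*\<^sup>* vs ws"
    if "vs \<in> verts (tree_cover G)" "ws \<in> verts (tree_cover G)" "(adj G)\<^sup>*\<^sup>* (hd vs) (hd ws)" for vs ws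
    using that tree_verts_reach_root[of vs G] tree_verts_reach_root[of ws G] comp_root_eq[OF that(3)]
    by (metis adj_rtranclp_sym rtranclp_trans verts_tree_cover)
qed (use sG simple_tree_cover tree_cover_hom tree_cover_lift[OF sG] in auto)

text \<open>Both cycle neighbours of a longest vertex of a cycle would be its tail.\<close>

lemma acyclic_tree_cover: "acyclic_graph (tree_cover G)"
  unfolding acyclic_graph_def
proof
  assume "\<exists>c. is_cycle (tree_cover G) c"
  then obtain c where c: "is_cycle (tree_cover G) c" by blast
  then have "length ` set c \<noteq> {}" by (auto simp: is_cycle_def)
  then have "Max (length ` set c) \<in> length ` set c" by (intro Max_in) auto
  then obtain x where x: "x \<in> set c" "length x = Max (length ` set c)" by force
  have max: "length y \<le> length x" if "y \<in> set c" for y using that x(2) by simp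
  obtain y z where "y \<in> set c" "z \<in> set c" "y \<noteq> z"
    "adj (tree_cover G) x y" "adj (tree_cover G) x z" using is_cycle_neighbours[OF c x(1)] .
  then show False using max[of y] max[of z] by (auto simp: adj_tree_cover)
qed

section \<open>Short cycles and balls\<close>

text \<open>From \<open>hd c\<close>, position \<open>i\<close> is reached along two arcs, of
  lengths \<open>i\<close> and \<open>?n - i\<close>, and the shorter one is at most
  \<open>r/2\<close>.\<close>

lemma short_cycle_in_ball:
  assumes sG: "simple_graph G" and c: "is_cycle G c" and r: "length c \<le> r"
  shows "is_cycle (ball_half G (hd c) r) c"
proof -
  let ?n = "length c" and ?B = "ball_half G (hd c) r"
  have n: "3 \<le> ?n" and w: "walk G c" using c by (auto simp: is_cycle_def)
  have ne: "c \<noteq> []" using n by auto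
  have v: "hd c \<in> verts G" using w ne by (auto simp: walk_def)
  have fwd: "(adj G ^^ i) (hd c) (c ! i)" if i: "i < ?n" for i
  proof -
    have t: "take (Suc i) c = take i c @ [c ! i]" using i by (rule take_Suc_conv_app_nth)
    have "walk G (take (Suc i) c)"
      using w walk_append[of "take (Suc i) c" "drop (Suc i) c" G] ne
      by (cases "drop (Suc i) c = []") auto
    from walk_pow[OF this] show ?thesis using i ne by (simp add: t) (metis hd_take t zero_less_Suc)
  qed
  have bwd: "(adj G ^^ (?n - i)) (hd c) (c ! i)" if i: "i < ?n" for i
  proof -
    have "walk G (take i c @ (drop i c @ [hd c]))" using is_cycle_closed_walk[OF c]
      by (simp flip: append_assoc)
    then have "walk G (drop i c @ [hd c])"
      using walk_append[of "take i c" "drop i c @ [hd c]" G] by (cases "take i c = []") auto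
    from walk_pow[OF this] have "(adj G ^^ (?n - i)) (c ! i) (hd c)"
      using i by (simp add: hd_append hd_drop_conv_nth)
    then show ?thesis by (rule adj_pow_sym)
  qed
  have "c ! i \<in> verts ?B" if i: "i < ?n" for i
  proof (cases "2 * i \<le> r")
    case True
    then show ?thesis using ball_halfI[OF sG v fwd[OF i]] by blast
  next
    case False
    then show ?thesis using ball_halfI[OF sG v bwd[OF i]] r by auto
  qed
  then have V: "set c \<subseteq> verts ?B" by (auto simp: in_set_conv_nth)
  \<comment> \<open>Measuring one end along each arc gives the sum \<open>?n - 1\<close> for
    consecutive positions and 1 for the closing edge, both less than \<open>r\<close>.\<close>
  have edge: "{c ! i, c ! j} \<in> edges ?B"
    if "adj G (c ! i) (c ! j)" "i < ?n" "j < ?n" "j + (?n - i) < r \<or> i + (?n - j) < r" for i j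
  proof -
    have ne: "c ! i \<noteq> c ! j" using adj_verts[OF sG that(1)] by blast
    have "gdist G (hd c) (c ! k) \<le> enat k" "gdist G (hd c) (c ! k) \<le> enat (?n - k)" if "k < ?n" for k
      using gdist_le[OF sG v] fwd[OF that] bwd[OF that] by blast+
    then have "gdist G (hd c) (c ! i) + gdist G (hd c) (c ! j) \<le> enat (i + (?n - j))"
      "gdist G (hd c) (c ! i) + gdist G (hd c) (c ! j) \<le> enat (?n - i + j)"
      using that by (simp_all only: plus_enat_simps(1)[symmetric] add_mono)
    then have "gdist G (hd c) (c ! i) + gdist G (hd c) (c ! j) < enat r"
      using that(4) by (auto elim: le_less_trans simp: add.commute)
    then show ?thesis using that(1) ball_half_edge[OF ne] by blast
  qed
  have "{c ! i, c ! Suc i} \<in> edges ?B" if "Suc i < ?n" for i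
    by (rule edge) (use that w r in \<open>auto simp: walk_def adj_def successively_conv_nth\<close>)
  moreover have "{c ! (?n - 1), c ! 0} \<in> edges ?B"
    by (rule edge) (use c n r ne in \<open>auto simp: is_cycle_def adj_def last_conv_nth hd_conv_nth\<close>)
  ultimately show ?thesis
    using c V ne by (auto simp: is_cycle_def walk_def successively_conv_nth last_conv_nth hd_conv_nth)
qed

theorem theorem4p1:
  fixes G :: "'a graph" and r :: nat and Gr :: "'b graph" and pr :: "'b \<Rightarrow> 'a"
  assumes "simple_graph G"
    and "local_covering r Gr G pr"
  shows "(locally_acyclic r G \<longleftrightarrow> girth G > enat r) \<and>
         (girth G > enat r \<longleftrightarrow> acyclic_graph Gr)"
proof -
  have cov: "covering Gr G pr" and bp: "ball_preserving r Gr G pr"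
    using assms(2) by (auto simp: local_covering_def)
  have "girth G > enat r" if loc: "locally_acyclic r G"
    unfolding girth_greater_iff
  proof (intro allI impI, rule ccontr)
    fix c assume c: "is_cycle G c" and "\<not> r < length c"
    then have "is_cycle (ball_half G (hd c) r) c" using short_cycle_in_ball[OF assms(1)] by simp
    moreover have "hd c \<in> verts G" using c by (auto simp: is_cycle_def walk_def)
    ultimately show False using loc by (auto simp: locally_acyclic_def acyclic_graph_def)
  qed
  moreover have "acyclic_graph Gr" if "girth G > enat r"
  proof -
    have "ball_preserving r (tree_cover G) G hd"
      using covering_large_girth_ball_preserving[OF covering_tree_cover[OF assms(1)]] that
      by (simp add: girth_greater_iff)
    \<comment> \<open>The vertices of \<open>tree_cover G\<close> are lists over \<open>'a\<close>,
      so it is among the competitors in \<open>local_covering\<close>.\<close>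
    then obtain q where "covering Gr (tree_cover G) q"
      using assms(2) covering_tree_cover[OF assms(1)] unfolding local_covering_def by blast
    then show ?thesis using covering_acyclic acyclic_tree_cover by blast
  qed
  moreover have "locally_acyclic r G" if ac: "acyclic_graph Gr"
    unfolding locally_acyclic_def
  proof
    fix v assume "v \<in> verts G"
    then obtain x where x: "x \<in> verts Gr" "pr x = v" using covering_surj[OF cov] by blast
    \<comment> \<open>Balls of \<open>Gr\<close> are subgraphs of a forest, and every ball of
      \<open>G\<close> is isomorphic to one of them.\<close>
    have "acyclic_graph (ball_half Gr x r)"
      using ac is_cycle_subgraph[of "ball_half Gr x r" Gr]
      by (auto simp: acyclic_graph_def ball_half_def)
    moreover have "graph_iso (ball_half Gr x r) (ball_half G v r) pr"
      using bp x by (auto simp: ball_preserving_def)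
    ultimately show "acyclic_graph (ball_half G v r)" using graph_iso_acyclic by blast
  qed
  ultimately show ?thesis by blast
qed

end
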